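(* For a topological group $G$, the local state classifier $\Xi$ of the Grothendieck topos $\mathbf{Cont}(G)$ of continuous $G$-actions is given by $$\Xi=\{\text{open subgroups of }G\},$$ equipped with the right conjugate action $H\cdot g:=g^{-1}Hg$.
   Context: $\mathbf{Cont}(G)$ is the category whose objects are sets $X$ with a right $G$-action such that $X\times G\to X$ is continuous when $X$ carries the discrete topology (equivalently, the stabilizer of every element is an open subgroup), and whose morphisms are $G$-equivariant maps. Local state classifier: for a category $\mathcal{E}$, let $\mathcal{E}_{\mathrm{mono}}$ be the category with the same objects and with the monomorphisms of $\mathcal{E}$ as morphisms. The local state classifier of $\mathcal{E}$ is the (possibly large) colimit of the inclusion functor $\mathcal{E}_{\mathrm{mono}}\to\mathcal{E}$, i.e. an object $\Xi$ with a family $\{\xi_X\colon X\to\Xi\}_{X\in\mathrm{ob}(\mathcal{E})}$ such that $\xi_Y\circ m=\xi_X$ for every monomorphism $m\colon X\rightarrowtail Y$, and which is universal among such families: for every object $L$ and family $\{\phi_X\colon X\to L\}_X$ with $\phi_Y\circ m=\phi_X$ for all monomorphisms $m\colon X\rightarrowtail Y$, there is a unique $u\colon\Xi\to L$ with $u\circ\xi_X=\phi_X$ for all $X$. *)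

theory Defs
  imports "HOL-Analysis.Analysis" "HOL-Algebra.Coset"
begin

text \<open>Composition takes the three objects involved as arguments (\<open>Comp E X Y Z g f\<close> is
  \<open>g \<circ> f\<close> for \<open>f : X \<rightarrow> Y\<close> and \<open>g : Y \<rightarrow> Z\<close>), so the sets \<open>Mor E X Y\<close> need not be disjoint.\<close>

record ('o, 'm) cat =
  Ob :: "'o set"
  Mor :: "'o \<Rightarrow> 'o \<Rightarrow> 'm set"
  Comp :: "'o \<Rightarrow> 'o \<Rightarrow> 'o \<Rightarrow> 'm \<Rightarrow> 'm \<Rightarrow> 'm"
  Ident :: "'o \<Rightarrow> 'm"

locale category =
  fixes E :: "('o, 'm, 'z) cat_scheme"
  assumes ident_mor: "X \<in> Ob E \<Longrightarrow> Ident E X \<in> Mor E X X"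
    and comp_mor: "\<lbrakk>X \<in> Ob E; Y \<in> Ob E; Z \<in> Ob E; f \<in> Mor E X Y; g \<in> Mor E Y Z\<rbrakk>
      \<Longrightarrow> Comp E X Y Z g f \<in> Mor E X Z"
    and comp_ident_right: "\<lbrakk>X \<in> Ob E; Y \<in> Ob E; f \<in> Mor E X Y\<rbrakk>
      \<Longrightarrow> Comp E X X Y f (Ident E X) = f"
    and comp_ident_left: "\<lbrakk>X \<in> Ob E; Y \<in> Ob E; f \<in> Mor E X Y\<rbrakk>
      \<Longrightarrow> Comp E X Y Y (Ident E Y) f = f"
    and comp_assoc: "\<lbrakk>W \<in> Ob E; X \<in> Ob E; Y \<in> Ob E; Z \<in> Ob E;
        f \<in> Mor E W X; g \<in> Mor E X Y; h \<in> Mor E Y Z\<rbrakk>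
      \<Longrightarrow> Comp E W Y Z h (Comp E W X Y g f) = Comp E W X Z (Comp E X Y Z h g) f"

definition monomorphism :: "('o, 'm, 'z) cat_scheme \<Rightarrow> 'o \<Rightarrow> 'o \<Rightarrow> 'm \<Rightarrow> bool" where
  "monomorphism E X Y m \<longleftrightarrow> m \<in> Mor E X Y \<and>
    (\<forall>Z\<in>Ob E. \<forall>f\<in>Mor E Z X. \<forall>g\<in>Mor E Z X. Comp E Z X Y m f = Comp E Z X Y m g \<longrightarrow> f = g)"

definition mono_cocone :: "('o, 'm, 'z) cat_scheme \<Rightarrow> 'o \<Rightarrow> ('o \<Rightarrow> 'm) \<Rightarrow> bool" where
  "mono_cocone E L \<phi> \<longleftrightarrow> L \<in> Ob E \<and> (\<forall>X\<in>Ob E. \<phi> X \<in> Mor E X L) \<and>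
    (\<forall>X\<in>Ob E. \<forall>Y\<in>Ob E. \<forall>m. monomorphism E X Y m \<longrightarrow> Comp E X Y L (\<phi> Y) m = \<phi> X)"

definition local_state_classifier :: "('o, 'm, 'z) cat_scheme \<Rightarrow> 'o \<Rightarrow> ('o \<Rightarrow> 'm) \<Rightarrow> bool" where
  "local_state_classifier E \<Xi> \<xi> \<longleftrightarrow> mono_cocone E \<Xi> \<xi> \<and>
    (\<forall>L \<phi>. mono_cocone E L \<phi> \<longrightarrow>
      (\<exists>!u. u \<in> Mor E \<Xi> L \<and> (\<forall>X\<in>Ob E. Comp E X \<Xi> L u (\<xi> X) = \<phi> X)))"

locale topological_group = group G for G :: "('g, 'b) monoid_scheme" (structure) +
  fixes T :: "'g topology"
  assumes topspace_eq_carrier: "topspace T = carrier G"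
    and continuous_mult: "continuous_map (prod_topology T T) T (\<lambda>(x, y). x \<otimes> y)"
    and continuous_inv: "continuous_map T T (\<lambda>x. inv x)"

record ('x, 'g) gset =
  pts :: "'x set"
  act :: "'x \<times> 'g \<Rightarrow> 'x"

text \<open>The action map is required to be \<open>undefined\<close> off \<open>pts X \<times> carrier G\<close>, so that equality of
  records is equality of \<open>G\<close>-sets; likewise for morphisms below.\<close>

definition continuous_gset :: "('g, 'b) monoid_scheme \<Rightarrow> 'g topology \<Rightarrow> ('x, 'g) gset \<Rightarrow> bool" where
  "continuous_gset G T X \<longleftrightarrow>
    act X \<in> (pts X \<times> carrier G) \<rightarrow>\<^sub>E pts X \<and>
    (\<forall>x\<in>pts X. act X (x, \<one>\<^bsub>G\<^esub>) = x) \<and>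
    (\<forall>x\<in>pts X. \<forall>g\<in>carrier G. \<forall>h\<in>carrier G. act X (act X (x, g), h) = act X (x, g \<otimes>\<^bsub>G\<^esub> h)) \<and>
    continuous_map (prod_topology (discrete_topology (pts X)) T) (discrete_topology (pts X)) (act X)"

definition equivariant_maps ::
  "('g, 'b) monoid_scheme \<Rightarrow> ('x, 'g) gset \<Rightarrow> ('y, 'g) gset \<Rightarrow> ('x \<Rightarrow> 'y) set" where
  "equivariant_maps G X Y = {f \<in> pts X \<rightarrow>\<^sub>E pts Y.
    \<forall>x\<in>pts X. \<forall>g\<in>carrier G. f (act X (x, g)) = act Y (f x, g)}"

text \<open>HOL has no type of all sets, so the category is taken relative to a collection \<open>U\<close> of
  subsets of a type \<open>'u\<close>, the small sets.  Only closure under subsets and images is required of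
  \<open>U\<close>.  Examples are the sets of a Grothendieck universe, the small classes of a type that models
  ZFC (giving the category of all continuous \<open>G\<close>-sets), and the collection of all subsets of \<open>'u\<close>.\<close>

definition small_sets :: "'u set set \<Rightarrow> bool" where
  "small_sets U \<longleftrightarrow> (\<forall>A\<in>U. \<forall>B. B \<subseteq> A \<longrightarrow> B \<in> U) \<and> (\<forall>A\<in>U. \<forall>f. f ` A \<in> U)"

lemma small_sets_UNIV: "small_sets UNIV"
  by (simp add: small_sets_def)

definition Cont :: "'u set set \<Rightarrow> ('g, 'b) monoid_scheme \<Rightarrow> 'g topology
    \<Rightarrow> (('u, 'g) gset, 'u \<Rightarrow> 'u) cat" where
  "Cont U G T =
    \<lparr>Ob = {X. pts X \<in> U \<and> continuous_gset G T X},
     Mor = equivariant_maps G,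
     Comp = (\<lambda>X Y Z g f. compose (pts X) g f),
     Ident = (\<lambda>X. \<lambda>x\<in>pts X. x)\<rparr>"

lemma category_Cont:
  fixes U :: "'u set set" and G :: "('g, 'b) monoid_scheme" and T :: "'g topology"
  shows "category (Cont U G T)"
proof (unfold_locales, goal_cases)
  case (1 X)
  then show ?case
    by (auto simp: Cont_def equivariant_maps_def continuous_gset_def PiE_iff)
next
  case (2 X Y Z f g)
  then have "act X (x, h) \<in> pts X" if "x \<in> pts X" "h \<in> carrier G" for x h
    using that by (auto simp: Cont_def continuous_gset_def PiE_iff)
  moreover have "f x \<in> pts Y" if "x \<in> pts X" for x
    using that 2 by (auto simp: Cont_def equivariant_maps_def PiE_iff)
  ultimately show ?case
    using 2 by (auto simp: Cont_def equivariant_maps_def compose_def PiE_iff)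
next
  case (3 X Y f)
  then show ?case
    by (auto simp: Cont_def equivariant_maps_def compose_def fun_eq_iff PiE_iff extensional_def)
next
  case (4 X Y f)
  then show ?case
    by (auto simp: Cont_def equivariant_maps_def compose_def fun_eq_iff PiE_iff extensional_def)
next
  case (5 V X Y Z f g h)
  then show ?case
    by (auto simp: Cont_def equivariant_maps_def compose_def fun_eq_iff PiE_iff)
qed

definition open_subgroups :: "('g, 'b) monoid_scheme \<Rightarrow> 'g topology \<Rightarrow> 'g set set" where
  "open_subgroups G T = {H. subgroup H G \<and> openin T H}"

definition open_subgroups_gset ::
  "('g, 'b) monoid_scheme \<Rightarrow> 'g topology \<Rightarrow> ('g set, 'g) gset" where
  "open_subgroups_gset G T =
    \<lparr>pts = open_subgroups G T,
     act = (\<lambda>(H, g) \<in> open_subgroups G T \<times> carrier G. (inv\<^bsub>G\<^esub> g <#\<^bsub>G\<^esub> H) #>\<^bsub>G\<^esub> g)\<rparr>"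

text \<open>The copy of a \<open>G\<close>-set along an injection of its underlying set; it is used to view a
  \<open>G\<close>-set on another type as an object of \<open>Cont U G T\<close>.\<close>

definition transport_gset ::
  "('g, 'b) monoid_scheme \<Rightarrow> ('x \<Rightarrow> 'y) \<Rightarrow> ('x, 'g) gset \<Rightarrow> ('y, 'g) gset" where
  "transport_gset G \<iota> X =
    \<lparr>pts = \<iota> ` pts X,
     act = (\<lambda>(y, g) \<in> \<iota> ` pts X \<times> carrier G. \<iota> (act X (the_inv_into (pts X) \<iota> y, g)))\<rparr>"

end

theory Submission
  imports Defs
begin

text \<open>The classifying map sends a point \<open>x\<close> to its stabilizer.  Each point \<open>x\<close> is the image of the
  base point under the embedding of the coset space \<open>G / Stab x\<close> onto the orbit of \<open>x\<close>, so a
  mono-cocone is determined by its values at the base points of the spaces \<open>G / H\<close>, with \<open>H\<close> an open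
  subgroup.  These values form an equivariant function of \<open>H\<close>, because the point \<open>Hg\<close> of \<open>G / H\<close> has
  stabilizer \<open>g\<^sup>-\<^sup>1Hg\<close>.  Monomorphisms are injective: if \<open>m\<close> identifies \<open>x\<close> and \<open>y\<close>, test it against
  the two orbit maps of \<open>x\<close> and \<open>y\<close> out of \<open>G / (Stab x \<inter> Stab y)\<close>.\<close>

section \<open>Stabilizers and coset spaces\<close>

definition stabilizer :: "('g, 'b) monoid_scheme \<Rightarrow> ('x, 'g) gset \<Rightarrow> 'x \<Rightarrow> 'g set" where
  "stabilizer G X x = {g \<in> carrier G. act X (x, g) = x}"

text \<open>Right cosets, because the action is on the right: this is the transitive
  \<open>G\<close>-set written \<open>G / H\<close> above.\<close>

definition coset_gset :: "('g, 'b) monoid_scheme \<Rightarrow> 'g set \<Rightarrow> ('g set, 'g) gset" where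
  "coset_gset G H =
    \<lparr>pts = rcosets\<^bsub>G\<^esub> H, act = (\<lambda>(C, g) \<in> (rcosets\<^bsub>G\<^esub> H) \<times> carrier G. C #>\<^bsub>G\<^esub> g)\<rparr>"

lemma pts_transport_gset [simp]: "pts (transport_gset G \<iota> X) = \<iota> ` pts X"
  by (simp add: transport_gset_def)

lemma act_transport_gset:
  assumes "inj_on \<iota> (pts X)" "x \<in> pts X" "g \<in> carrier G"
  shows "act (transport_gset G \<iota> X) (\<iota> x, g) = \<iota> (act X (x, g))"
  using assms by (simp add: transport_gset_def the_inv_into_f_f)

section \<open>Conjugates and right cosets in an abstract group\<close>

context group
begin

text \<open>Turns identities between conjugates, which are set products, into computations with
  single elements.\<close>

lemma mem_conjugate_iff:
  assumes "H \<subseteq> carrier G" "g \<in> carrier G"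
  shows "x \<in> (inv g <# H) #> g \<longleftrightarrow> x \<in> carrier G \<and> g \<otimes> x \<otimes> inv g \<in> H"
proof
  assume "x \<in> (inv g <# H) #> g"
  then obtain h where h: "h \<in> H" "x = inv g \<otimes> h \<otimes> g"
    by (auto simp: l_coset_def r_coset_def)
  then have "h \<in> carrier G"
    using assms by auto
  \<comment> \<open>Associating to the right cancels the pair \<open>g \<otimes> inv g\<close> at
    the end, associating to the left then cancels the one at the front.\<close>
  moreover from this have "g \<otimes> x \<otimes> inv g = h"
    using h assms by (simp add: m_assoc) (simp add: m_assoc [symmetric])
  ultimately show "x \<in> carrier G \<and> g \<otimes> x \<otimes> inv g \<in> H"
    using h assms by simp
next
  assume x: "x \<in> carrier G \<and> g \<otimes> x \<otimes> inv g \<in> H"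
  then have "x = inv g \<otimes> (g \<otimes> x \<otimes> inv g) \<otimes> g"
    using assms by (simp add: m_assoc) (simp add: m_assoc [symmetric])
  then show "x \<in> (inv g <# H) #> g"
    using x unfolding l_coset_def r_coset_def by blast
qed

lemma subgroup_conjugate:
  assumes "subgroup H G" "g \<in> carrier G"
  shows "subgroup ((inv g <# H) #> g) G"
proof -
  have H: "H \<subseteq> carrier G"
    using assms subgroup.subset by blast
  note mem = mem_conjugate_iff [OF H assms(2)]
  show ?thesis
  proof (rule subgroupI)
    show "(inv g <# H) #> g \<subseteq> carrier G"
      using mem by blast
    have "\<one> \<in> (inv g <# H) #> g"
      using assms by (simp add: mem subgroup.one_closed)
    then show "(inv g <# H) #> g \<noteq> {}"
      by blast
  next
    fix a assume a: "a \<in> (inv g <# H) #> g"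
    then have "inv (g \<otimes> a \<otimes> inv g) \<in> H"
      using subgroup.m_inv_closed [OF assms(1)] by (simp add: mem)
    then show "inv a \<in> (inv g <# H) #> g"
      using a assms(2) by (simp add: mem inv_mult_group m_assoc)
  next
    fix a b assume ab: "a \<in> (inv g <# H) #> g" "b \<in> (inv g <# H) #> g"
    then have "(g \<otimes> a \<otimes> inv g) \<otimes> (g \<otimes> b \<otimes> inv g) \<in> H"
      using subgroup.m_closed [OF assms(1)] by (simp add: mem)
    moreover have "(g \<otimes> a \<otimes> inv g) \<otimes> (g \<otimes> b \<otimes> inv g) = g \<otimes> (a \<otimes> b) \<otimes> inv g"
    proof -
      \<comment> \<open>In right-associated form this cancels the inner pair between the two
        conjugated factors.\<close>
      have "inv g \<otimes> (g \<otimes> z) = z" if "z \<in> carrier G" for z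
        using that assms(2) by (simp flip: m_assoc)
      then show ?thesis
        using ab assms(2) by (simp add: mem m_assoc)
    qed
    ultimately show "a \<otimes> b \<in> (inv g <# H) #> g"
      using ab by (simp add: mem)
  qed
qed

lemma conjugate_one:
  assumes "H \<subseteq> carrier G"
  shows "(inv \<one> <# H) #> \<one> = H"
proof (rule Set.set_eqI)
  fix x show "x \<in> (inv \<one> <# H) #> \<one> \<longleftrightarrow> x \<in> H"
    unfolding mem_conjugate_iff [OF assms one_closed] using assms by auto
qed

text \<open>Both sides contain \<open>x\<close> exactly when conjugating \<open>x\<close> first by
  \<open>h\<close> and then by \<open>g\<close> lands in \<open>H\<close>. The order of the factors
  makes this a right action.\<close>

lemma conjugate_mult:
  assumes "H \<subseteq> carrier G" "g \<in> carrier G" "h \<in> carrier G"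
  shows "(inv h <# ((inv g <# H) #> g)) #> h = (inv (g \<otimes> h) <# H) #> (g \<otimes> h)"
proof -
  have "(inv g <# H) #> g \<subseteq> carrier G"
    using assms by (auto simp: mem_conjugate_iff)
  note mem = mem_conjugate_iff [OF this assms(3)] mem_conjugate_iff [OF assms(1,2)]
    mem_conjugate_iff [OF assms(1) m_closed [OF assms(2,3)]]
  show ?thesis
  proof (rule Set.set_eqI)
    fix x show "x \<in> (inv h <# ((inv g <# H) #> g)) #> h \<longleftrightarrow> x \<in> (inv (g \<otimes> h) <# H) #> (g \<otimes> h)"
      unfolding mem using assms(2,3) by (auto simp: inv_mult_group m_assoc)
  qed
qed

text \<open>Translating \<open>H\<close> on either side by one of its own elements gives
  \<open>H\<close> back. Hence the point \<open>H\<close> of the classifier is fixed by the subgroup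
  \<open>H\<close>.\<close>

lemma conjugate_self:
  assumes "subgroup H G" "h \<in> H"
  shows "(inv h <# H) #> h = H"
proof -
  have "inv h <# H = H"
    using assms by (meson coset_join3 subgroup.m_inv_closed subgroup.mem_carrier)
  then show ?thesis
    using assms by (metis coset_join2 subgroup.mem_carrier)
qed

lemma rcos_conjugate:
  assumes "subgroup H G" "a \<in> carrier G" "g \<in> carrier G"
  shows "(H #> a) #> g = H #> a \<longleftrightarrow> g \<in> (inv a <# H) #> a"
proof -
  have H: "H \<subseteq> carrier G"
    using assms subgroup.subset by blast
  have "(H #> a) #> g = H #> a \<longleftrightarrow> H #> (a \<otimes> g) = H #> a"
    using assms H by (simp add: coset_mult_assoc)
  \<comment> \<open>Translate both cosets by \<open>inv a\<close>; for \<open>c\<close> in the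
    group, \<open>H #> c = H\<close> means \<open>c \<in> H\<close>.\<close>
  also have "\<dots> \<longleftrightarrow> a \<otimes> g \<otimes> inv a \<in> H"
    using assms H
    by (metis coset_join1 coset_join2 coset_mult_inv1 coset_mult_inv2 inv_closed m_closed)
  finally show ?thesis
    using assms H by (simp add: mem_conjugate_iff)
qed

text \<open>Places the points of \<open>G / H\<close> in the domain on which the embedding
  \<open>\<iota>\<close> will be injective.\<close>

lemma rcosets_subset_Pow: "subgroup H G \<Longrightarrow> rcosets H \<subseteq> Pow (carrier G)"
  using subgroup.rcosets_carrier is_group by blast

lemma subgroup_in_rcosets: "subgroup H G \<Longrightarrow> H \<in> rcosets H"
  by (metis coset_mult_one one_closed rcosetsI subgroup.subset)

end

section \<open>Open subgroups and a criterion for continuity of an action\<close>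

context topological_group
begin

lemma open_subgroups_subset_Pow: "open_subgroups G T \<subseteq> Pow (carrier G)"
  by (auto simp: open_subgroups_def dest: subgroup.mem_carrier)

lemma continuous_map_right_mult:
  assumes "g \<in> carrier G"
  shows "continuous_map T T (\<lambda>x. x \<otimes> g)"
proof -
  have "continuous_map T (prod_topology T T) (\<lambda>x. (x, g))"
    using assms by (simp add: continuous_map_pairedI topspace_eq_carrier)
  from continuous_map_compose [OF this continuous_mult] show ?thesis
    by (simp add: o_def)
qed

lemma continuous_map_left_mult:
  assumes "g \<in> carrier G"
  shows "continuous_map T T (\<lambda>x. g \<otimes> x)"
proof -
  have "continuous_map T (prod_topology T T) (\<lambda>x. (g, x))"
    using assms by (simp add: continuous_map_pairedI topspace_eq_carrier)
  from continuous_map_compose [OF this continuous_mult] show ?thesis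
    by (simp add: o_def)
qed

text \<open>The coset is the preimage of \<open>H\<close> under the continuous right translation by
  \<open>inv g\<close>.\<close>

lemma openin_r_coset:
  assumes "openin T H" "g \<in> carrier G"
  shows "openin T (H #> g)"
proof -
  have H: "H \<subseteq> carrier G"
    using assms openin_subset topspace_eq_carrier by blast
  have "H #> g = {x \<in> topspace T. x \<otimes> inv g \<in> H}"
  proof (intro equalityI subsetI)
    fix x assume "x \<in> H #> g"
    then show "x \<in> {x \<in> topspace T. x \<otimes> inv g \<in> H}"
      using H assms(2) by (auto simp: r_coset_def topspace_eq_carrier m_assoc subsetD)
  next
    fix x assume "x \<in> {x \<in> topspace T. x \<otimes> inv g \<in> H}"
    moreover from this have "x = x \<otimes> inv g \<otimes> g"
      using assms(2) by (simp add: topspace_eq_carrier m_assoc)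
    ultimately show "x \<in> H #> g"
      unfolding r_coset_def by blast
  qed
  then show ?thesis
    using assms openin_continuous_map_preimage [OF continuous_map_right_mult] by simp
qed

lemma openin_conjugate:
  assumes "openin T H" "g \<in> carrier G"
  shows "openin T ((inv g <# H) #> g)"
proof -
  have "continuous_map T T (\<lambda>x. g \<otimes> x \<otimes> inv g)"
    using continuous_map_compose [OF continuous_map_left_mult continuous_map_right_mult] assms(2)
    by (simp add: o_def)
  then have "openin T {x \<in> topspace T. g \<otimes> x \<otimes> inv g \<in> H}"
    using assms(1) openin_continuous_map_preimage by blast
  moreover have "H \<subseteq> carrier G"
    using assms openin_subset topspace_eq_carrier by blast
  then have "(inv g <# H) #> g = {x \<in> topspace T. g \<otimes> x \<otimes> inv g \<in> H}"
    using assms by (auto simp: mem_conjugate_iff topspace_eq_carrier)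
  ultimately show ?thesis
    by simp
qed

text \<open>If an open subgroup \<open>H\<close> fixes \<open>x\<close>, the action is constant on
  the open neighbourhood \<open>{x} \<times> (H #> g)\<close> of \<open>(x, g)\<close>. So it
  suffices to find such a subgroup for each point.\<close>

lemma continuous_gsetI:
  assumes act: "act X \<in> (pts X \<times> carrier G) \<rightarrow>\<^sub>E pts X"
    and one: "\<And>x. x \<in> pts X \<Longrightarrow> act X (x, \<one>) = x"
    and mult: "\<And>x g h. \<lbrakk>x \<in> pts X; g \<in> carrier G; h \<in> carrier G\<rbrakk>
      \<Longrightarrow> act X (act X (x, g), h) = act X (x, g \<otimes> h)"
    and fixing: "\<And>x. x \<in> pts X \<Longrightarrow> \<exists>H \<in> open_subgroups G T. H \<subseteq> stabilizer G X x"
  shows "continuous_gset G T X"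
proof -
  have "continuous_map (prod_topology (discrete_topology (pts X)) T) (discrete_topology (pts X)) (act X)"
    unfolding continuous_map_def
  proof (intro conjI allI impI)
    show "act X \<in> topspace (prod_topology (discrete_topology (pts X)) T) \<rightarrow> topspace (discrete_topology (pts X))"
      using act by (auto simp: topspace_eq_carrier PiE_iff)
    fix V
    let ?S = "{p \<in> topspace (prod_topology (discrete_topology (pts X)) T). act X p \<in> V}"
    have "\<exists>A B. openin (discrete_topology (pts X)) A \<and> openin T B \<and> x \<in> A \<and> g \<in> B \<and> A \<times> B \<subseteq> ?S"
      if "(x, g) \<in> ?S" for x g
    proof -
      have xg: "x \<in> pts X" "g \<in> carrier G" "act X (x, g) \<in> V"
        using that by (auto simp: topspace_eq_carrier)
      then obtain H where H: "subgroup H G" "openin T H" "H \<subseteq> stabilizer G X x"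
        using fixing by (auto simp: open_subgroups_def)
      have "act X (x, h \<otimes> g) = act X (x, g)" if "h \<in> H" for h
      proof -
        have "h \<in> carrier G" "act X (x, h) = x"
          using that H by (auto simp: stabilizer_def)
        then show ?thesis
          using mult [of x h g] xg by simp
      qed
      moreover have "h \<otimes> g \<in> carrier G" if "h \<in> H" for h
        using that H xg by (auto simp: stabilizer_def)
      ultimately have "{x} \<times> (H #> g) \<subseteq> ?S"
        using xg by (auto simp: r_coset_def topspace_eq_carrier)
      moreover have "g \<in> H #> g"
        using H xg by (simp add: rcos_self)
      ultimately show ?thesis
        using openin_r_coset H xg
        by (intro exI [of _ "{x}"] exI [of _ "H #> g"]) auto
    qed
    then show "openin (prod_topology (discrete_topology (pts X)) T) ?S"
      unfolding openin_prod_topology_alt by blast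
  qed
  then show ?thesis
    using act one mult by (simp add: continuous_gset_def)
qed

section \<open>Orbits and stabilizers in a continuous \<open>G\<close>-set\<close>

context
  fixes X :: "('x, 'g) gset"
  assumes X: "continuous_gset G T X"
begin

lemma act_closed: "\<lbrakk>x \<in> pts X; g \<in> carrier G\<rbrakk> \<Longrightarrow> act X (x, g) \<in> pts X"
  using X by (auto simp: continuous_gset_def PiE_iff)

lemma act_one: "x \<in> pts X \<Longrightarrow> act X (x, \<one>) = x"
  using X by (auto simp: continuous_gset_def)

lemma act_mult:
  "\<lbrakk>x \<in> pts X; g \<in> carrier G; h \<in> carrier G\<rbrakk> \<Longrightarrow> act X (act X (x, g), h) = act X (x, g \<otimes> h)"
  using X by (auto simp: continuous_gset_def)

text \<open>Act by \<open>inv b\<close> on both sides. The same criterion holds at the base point of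
  a coset space (\<open>coset_eq_iff\<close>), and comparing the two yields the orbit maps.\<close>

lemma act_eq_iff:
  assumes "x \<in> pts X" "a \<in> carrier G" "b \<in> carrier G"
  shows "act X (x, a) = act X (x, b) \<longleftrightarrow> a \<otimes> inv b \<in> stabilizer G X x"
proof
  assume "act X (x, a) = act X (x, b)"
  then have "act X (x, a \<otimes> inv b) = act X (x, b \<otimes> inv b)"
    using assms by (metis act_mult inv_closed)
  then show "a \<otimes> inv b \<in> stabilizer G X x"
    using assms by (simp add: stabilizer_def act_one)
next
  assume "a \<otimes> inv b \<in> stabilizer G X x"
  then have "act X (x, (a \<otimes> inv b) \<otimes> b) = act X (x, b)"
    using assms by (simp add: stabilizer_def flip: act_mult)
  then show "act X (x, a) = act X (x, b)"
    using assms by (simp add: m_assoc)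
qed

text \<open>Openness: the stabilizer is the preimage of the open set \<open>{x}\<close> under
  \<open>g \<mapsto> act X (x, g)\<close>, the restriction of the action to one slice.\<close>

lemma stabilizer_open_subgroup:
  assumes x: "x \<in> pts X"
  shows "stabilizer G X x \<in> open_subgroups G T"
proof -
  have "subgroup (stabilizer G X x) G"
  proof (rule subgroupI)
    fix a assume "a \<in> stabilizer G X x"
    then show "inv a \<in> stabilizer G X x"
      \<comment> \<open>With \<open>\<one>\<close> and \<open>a\<close> as the two group elements,
        the criterion puts \<open>\<one> \<otimes> inv a\<close> in the stabilizer.\<close>
      using x act_eq_iff [of x \<one> a] act_one by (simp add: stabilizer_def)
  next
    fix a b assume "a \<in> stabilizer G X x" "b \<in> stabilizer G X x"
    then show "a \<otimes> b \<in> stabilizer G X x"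
      using x by (simp add: stabilizer_def flip: act_mult)
  qed (use x act_one in \<open>auto simp: stabilizer_def\<close>)
  moreover have "continuous_map T (prod_topology (discrete_topology (pts X)) T) (\<lambda>g. (x, g))"
    using x by (simp add: continuous_map_pairedI)
  then have "continuous_map T (discrete_topology (pts X)) (\<lambda>g. act X (x, g))"
    using X continuous_map_compose by (fastforce simp: continuous_gset_def o_def)
  then have "openin T {g \<in> topspace T. act X (x, g) \<in> {x}}"
    using x by (intro openin_continuous_map_preimage) auto
  ultimately show ?thesis
    by (simp add: open_subgroups_def stabilizer_def topspace_eq_carrier)
qed

text \<open>An element \<open>h\<close> fixes the translate of \<open>x\<close> by \<open>g\<close>
  exactly when \<open>g \<otimes> h \<otimes> inv g\<close> fixes \<open>x\<close>. This makes the
  passage from points to stabilizers equivariant.\<close>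

lemma stabilizer_act:
  assumes x: "x \<in> pts X" and g: "g \<in> carrier G"
  shows "stabilizer G X (act X (x, g)) = (inv g <# stabilizer G X x) #> g"
proof -
  have "stabilizer G X x \<subseteq> carrier G"
    by (auto simp: stabilizer_def)
  moreover have "act X (act X (x, g), h) = act X (x, g) \<longleftrightarrow> g \<otimes> h \<otimes> inv g \<in> stabilizer G X x"
    if "h \<in> carrier G" for h
    using that x g by (simp add: act_mult act_eq_iff)
  ultimately show ?thesis
    using g by (auto simp: mem_conjugate_iff) (auto simp: stabilizer_def)
qed

text \<open>Whatever fixes \<open>x\<close> also fixes \<open>\<iota> x\<close>, so the open
  stabilizer of \<open>x\<close> serves in the continuity criterion.\<close>

lemma continuous_transport_gset:
  assumes \<iota>: "inj_on \<iota> (pts X)"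
  shows "continuous_gset G T (transport_gset G \<iota> X)"
proof (rule continuous_gsetI)
  show "act (transport_gset G \<iota> X) \<in> pts (transport_gset G \<iota> X) \<times> carrier G \<rightarrow>\<^sub>E pts (transport_gset G \<iota> X)"
    using \<iota> act_closed by (auto simp: transport_gset_def the_inv_into_f_f)
  fix y assume "y \<in> pts (transport_gset G \<iota> X)"
  then obtain x where x: "x \<in> pts X" "y = \<iota> x"
    by auto
  show "act (transport_gset G \<iota> X) (y, \<one>) = y"
    using x \<iota> act_one by (simp add: act_transport_gset)
  have "stabilizer G X x \<subseteq> stabilizer G (transport_gset G \<iota> X) y"
    using x \<iota> by (auto simp: stabilizer_def act_transport_gset)
  then show "\<exists>H\<in>open_subgroups G T. H \<subseteq> stabilizer G (transport_gset G \<iota> X) y"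
    using x stabilizer_open_subgroup by blast
  fix g h assume "g \<in> carrier G" "h \<in> carrier G"
  then show "act (transport_gset G \<iota> X) (act (transport_gset G \<iota> X) (y, g), h) =
      act (transport_gset G \<iota> X) (y, g \<otimes> h)"
    using x \<iota> act_closed act_mult by (simp add: act_transport_gset)
qed

end

text \<open>Each subgroup normalizes itself, so the open subgroup fixing the point \<open>H\<close>
  can be taken to be \<open>H\<close>.\<close>

lemma continuous_open_subgroups_gset: "continuous_gset G T (open_subgroups_gset G T)"
proof (rule continuous_gsetI)
  have closed: "(inv g <# H) #> g \<in> open_subgroups G T"
    if "H \<in> open_subgroups G T" "g \<in> carrier G" for H g
    using that subgroup_conjugate openin_conjugate by (simp add: open_subgroups_def)
  then show "act (open_subgroups_gset G T) \<in>
      pts (open_subgroups_gset G T) \<times> carrier G \<rightarrow>\<^sub>E pts (open_subgroups_gset G T)"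
    by (auto simp: open_subgroups_gset_def)
  fix H assume "H \<in> pts (open_subgroups_gset G T)"
  then have H: "H \<in> open_subgroups G T" "subgroup H G" "H \<subseteq> carrier G"
    using subgroup.subset by (auto simp: open_subgroups_gset_def open_subgroups_def)
  show "act (open_subgroups_gset G T) (H, \<one>) = H"
    using H conjugate_one by (simp add: open_subgroups_gset_def)
  have "H \<subseteq> stabilizer G (open_subgroups_gset G T) H"
    using H conjugate_self by (auto simp: open_subgroups_gset_def stabilizer_def)
  then show "\<exists>K\<in>open_subgroups G T. K \<subseteq> stabilizer G (open_subgroups_gset G T) H"
    using H by blast
  fix g h assume "g \<in> carrier G" "h \<in> carrier G"
  then show "act (open_subgroups_gset G T) (act (open_subgroups_gset G T) (H, g), h) =
      act (open_subgroups_gset G T) (H, g \<otimes> h)"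
    using H closed conjugate_mult by (simp add: open_subgroups_gset_def)
qed

lemma stabilizer_coset_gset:
  assumes "subgroup H G" "a \<in> carrier G"
  shows "stabilizer G (coset_gset G H) (H #> a) = (inv a <# H) #> a"
proof -
  have "H \<subseteq> carrier G"
    using assms subgroup.subset by blast
  then show ?thesis
    using assms rcos_conjugate
    by (auto simp: stabilizer_def coset_gset_def rcosetsI mem_conjugate_iff)
qed

text \<open>The stabilizer of the coset \<open>H #> a\<close> is the conjugate of \<open>H\<close>
  by \<open>a\<close>, which is open because \<open>H\<close> is.\<close>

lemma continuous_coset_gset:
  assumes "H \<in> open_subgroups G T"
  shows "continuous_gset G T (coset_gset G H)"
proof (rule continuous_gsetI)
  have H: "subgroup H G" "openin T H" "H \<subseteq> carrier G"
    using assms subgroup.subset by (auto simp: open_subgroups_def)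
  have closed: "C #> g \<in> rcosets H" if "C \<in> rcosets H" "g \<in> carrier G" for C g
    using that H by (auto simp: RCOSETS_def coset_mult_assoc)
  then show "act (coset_gset G H) \<in> pts (coset_gset G H) \<times> carrier G \<rightarrow>\<^sub>E pts (coset_gset G H)"
    by (auto simp: coset_gset_def)
  fix C assume "C \<in> pts (coset_gset G H)"
  then obtain a where a: "a \<in> carrier G" "C = H #> a" "C \<in> rcosets H"
    by (auto simp: coset_gset_def RCOSETS_def)
  then have C: "C \<subseteq> carrier G"
    using H by (simp add: r_coset_subset_G)
  then show "act (coset_gset G H) (C, \<one>) = C"
    using a by (simp add: coset_gset_def)
  show "\<exists>K\<in>open_subgroups G T. K \<subseteq> stabilizer G (coset_gset G H) C"
    using a H by (intro bexI [of _ "(inv a <# H) #> a"])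
      (simp_all add: stabilizer_coset_gset open_subgroups_def subgroup_conjugate openin_conjugate)
  fix g h assume "g \<in> carrier G" "h \<in> carrier G"
  then show "act (coset_gset G H) (act (coset_gset G H) (C, g), h) = act (coset_gset G H) (C, g \<otimes> h)"
    using a closed C by (simp add: coset_gset_def coset_mult_assoc)
qed

end

text \<open>Equivariance moves \<open>f\<close> outside and injectivity cancels it; the last
  assumption keeps the translates of \<open>x\<close> in the domain where \<open>f\<close> is
  injective.\<close>

lemma stabilizer_inj_equivariant:
  assumes "f \<in> equivariant_maps G X Y" "inj_on f (pts X)" "x \<in> pts X"
    and "\<And>g. g \<in> carrier G \<Longrightarrow> act X (x, g) \<in> pts X"
  shows "stabilizer G Y (f x) = stabilizer G X x"
proof -
  have "act Y (f x, g) = f x \<longleftrightarrow> act X (x, g) = x" if "g \<in> carrier G" for g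
  proof -
    have "f (act X (x, g)) = act Y (f x, g)"
      using assms(1,3) that by (simp add: equivariant_maps_def)
    then show ?thesis
      using inj_on_eq_iff [OF assms(2,4,3)] that by metis
  qed
  then show ?thesis
    by (auto simp: stabilizer_def)
qed

section \<open>The classifier and its cocone inside the category of small continuous
  \<open>G\<close>-sets\<close>

locale small_continuous_gsets = topological_group G T
  for G :: "('g, 'b) monoid_scheme" (structure) and T :: "'g topology" +
  fixes U :: "'u set set" and \<iota> :: "'g set \<Rightarrow> 'u"
  assumes small: "small_sets U"
    and inj: "inj_on \<iota> (Pow (carrier G))"
    and image: "\<iota> ` Pow (carrier G) \<in> U"
begin

lemma Ob_Cont: "X \<in> Ob (Cont U G T) \<longleftrightarrow> pts X \<in> U \<and> continuous_gset G T X"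
  by (simp add: Cont_def)

lemma Mor_Cont [simp]: "Mor (Cont U G T) X Y = equivariant_maps G X Y"
  by (simp add: Cont_def)

lemma Comp_Cont [simp]: "Comp (Cont U G T) X Y Z g f = compose (pts X) g f"
  by (simp add: Cont_def)

lemma equivariantD:
  assumes "f \<in> equivariant_maps G X Y" "x \<in> pts X"
  shows "f x \<in> pts Y" "g \<in> carrier G \<Longrightarrow> f (act X (x, g)) = act Y (f x, g)"
  using assms by (auto simp: equivariant_maps_def PiE_iff)

text \<open>One embedding of \<open>Pow (carrier G)\<close> serves the classifier and all coset
  spaces, since their points are subsets of the group and \<open>U\<close> is closed under
  subsets.\<close>

lemma transport_Ob:
  assumes "continuous_gset G T X" "pts X \<subseteq> Pow (carrier G)"
  shows "transport_gset G \<iota> X \<in> Ob (Cont U G T)"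
proof -
  have "inj_on \<iota> (pts X)"
    using inj assms inj_on_subset by blast
  moreover have "\<iota> ` pts X \<subseteq> \<iota> ` Pow (carrier G)"
    using assms by blast
  then have "\<iota> ` pts X \<in> U"
    using small image unfolding small_sets_def by blast
  ultimately show ?thesis
    using assms by (simp add: Ob_Cont continuous_transport_gset)
qed

abbreviation coset_space :: "'g set \<Rightarrow> ('u, 'g) gset" where
  "coset_space H \<equiv> transport_gset G \<iota> (coset_gset G H)"

abbreviation classifier :: "('u, 'g) gset" where
  "classifier \<equiv> transport_gset G \<iota> (open_subgroups_gset G T)"

text \<open>The components of the universal cocone. Restriction to \<open>pts X\<close> meets the
  extensionality required of morphisms.\<close>

definition classifying_map :: "('u, 'g) gset \<Rightarrow> 'u \<Rightarrow> 'u" where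
  "classifying_map X = (\<lambda>x\<in>pts X. \<iota> (stabilizer G X x))"

lemma classifier_Ob: "classifier \<in> Ob (Cont U G T)"
  using open_subgroups_subset_Pow
  by (intro transport_Ob continuous_open_subgroups_gset) (simp add: open_subgroups_gset_def)

lemma pts_classifier: "pts classifier = \<iota> ` open_subgroups G T"
  by (simp add: open_subgroups_gset_def)

lemma act_classifier:
  assumes "H \<in> open_subgroups G T" "g \<in> carrier G"
  shows "act classifier (\<iota> H, g) = \<iota> ((inv g <# H) #> g)"
proof -
  have "inj_on \<iota> (pts (open_subgroups_gset G T))"
    using inj_on_subset [OF inj open_subgroups_subset_Pow] by (simp add: open_subgroups_gset_def)
  then show ?thesis
    using assms by (simp add: act_transport_gset open_subgroups_gset_def)
qed

lemma classifying_map_equivariant: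
  assumes "X \<in> Ob (Cont U G T)"
  shows "classifying_map X \<in> equivariant_maps G X classifier"
proof -
  have X: "continuous_gset G T X"
    using assms by (simp add: Ob_Cont)
  have "classifying_map X \<in> pts X \<rightarrow>\<^sub>E pts classifier"
    using stabilizer_open_subgroup [OF X] unfolding pts_classifier classifying_map_def by auto
  then show ?thesis
    using stabilizer_open_subgroup [OF X] act_closed [OF X] stabilizer_act [OF X]
    by (simp add: equivariant_maps_def classifying_map_def act_classifier)
qed

text \<open>Injectivity cancels \<open>m\<close> pointwise. This direction lets a cocone be
  evaluated along an orbit embedding.\<close>

lemma inj_on_monomorphism:
  assumes m: "m \<in> equivariant_maps G X Y" "inj_on m (pts X)"
  shows "monomorphism (Cont U G T) X Y m"
  unfolding monomorphism_def
proof (intro conjI ballI impI)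
  show "m \<in> Mor (Cont U G T) X Y"
    using m by simp
  fix Z f g
  assume "f \<in> Mor (Cont U G T) Z X" "g \<in> Mor (Cont U G T) Z X"
    and eq: "Comp (Cont U G T) Z X Y m f = Comp (Cont U G T) Z X Y m g"
  then have fg: "f \<in> pts Z \<rightarrow>\<^sub>E pts X" "g \<in> pts Z \<rightarrow>\<^sub>E pts X"
    by (auto simp: equivariant_maps_def)
  have "f z = g z" if "z \<in> pts Z" for z
  proof -
    have "m (f z) = m (g z)"
      using fun_cong [OF eq, of z] that by (simp add: compose_def)
    then show ?thesis
      using fg that by (meson inj_onD [OF m(2)] PiE_mem)
  qed
  with fg show "f = g"
    by (intro PiE_ext) auto
qed

section \<open>Equivariant maps out of a coset space\<close>

context
  fixes H :: "'g set"
  assumes H: "H \<in> open_subgroups G T"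
begin

lemma pts_coset_gset_subset_Pow: "pts (coset_gset G H) \<subseteq> Pow (carrier G)"
  using H rcosets_subset_Pow by (simp add: coset_gset_def open_subgroups_def)

lemma coset_space_Ob: "coset_space H \<in> Ob (Cont U G T)"
  using continuous_coset_gset [OF H] pts_coset_gset_subset_Pow by (rule transport_Ob)

lemma inj_coset_gset: "inj_on \<iota> (pts (coset_gset G H))"
  using inj pts_coset_gset_subset_Pow by (rule inj_on_subset)

lemma base_point: "\<iota> H \<in> pts (coset_space H)"
  using H by (auto simp: coset_gset_def open_subgroups_def subgroup_in_rcosets)

lemma act_base_point:
  assumes "a \<in> carrier G"
  shows "act (coset_space H) (\<iota> H, a) = \<iota> (H #> a)"
  using H assms inj_coset_gset
  by (simp add: act_transport_gset coset_gset_def open_subgroups_def subgroup_in_rcosets)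

text \<open>Transitivity: every point is a translate of the base point
  \<open>\<iota> H\<close>.\<close>

lemma coset_spaceE:
  assumes "z \<in> pts (coset_space H)"
  obtains a where "a \<in> carrier G" "z = act (coset_space H) (\<iota> H, a)"
proof -
  obtain a where "a \<in> carrier G" "z = \<iota> (H #> a)"
    using assms by (auto simp: coset_gset_def RCOSETS_def)
  then show thesis
    using that act_base_point by simp
qed

text \<open>By transitivity an equivariant map is determined by its value at the base point.\<close>

lemma coset_space_map_eqI:
  assumes "f \<in> equivariant_maps G (coset_space H) X" "g \<in> equivariant_maps G (coset_space H) X"
    and "f (\<iota> H) = g (\<iota> H)"
  shows "f = g"
proof (rule PiE_ext)
  show "f \<in> pts (coset_space H) \<rightarrow>\<^sub>E pts X" "g \<in> pts (coset_space H) \<rightarrow>\<^sub>E pts X"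
    using assms by (auto simp only: equivariant_maps_def)
  fix z assume "z \<in> pts (coset_space H)"
  then obtain a where "a \<in> carrier G" "z = act (coset_space H) (\<iota> H, a)"
    by (rule coset_spaceE)
  then show "f z = g z"
    using assms(3) equivariantD(2) [OF assms(1) base_point] equivariantD(2) [OF assms(2) base_point]
    by simp
qed

lemma coset_eq_iff:
  assumes "a \<in> carrier G" "b \<in> carrier G"
  shows "act (coset_space H) (\<iota> H, a) = act (coset_space H) (\<iota> H, b) \<longleftrightarrow> a \<otimes> inv b \<in> H"
proof -
  have sub: "subgroup H G" "H \<subseteq> carrier G"
    using H subgroup.subset by (auto simp: open_subgroups_def)
  have "H #> a \<in> pts (coset_gset G H)" "H #> b \<in> pts (coset_gset G H)"
    using assms sub by (auto simp: coset_gset_def rcosetsI)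
  then have "act (coset_space H) (\<iota> H, a) = act (coset_space H) (\<iota> H, b) \<longleftrightarrow> H #> a = H #> b"
    using assms inj_coset_gset by (simp add: act_base_point inj_on_eq_iff)
  also have "\<dots> \<longleftrightarrow> a \<otimes> inv b \<in> H"
    using assms sub by (metis coset_join1 coset_join2 coset_mult_inv1 coset_mult_inv2 inv_closed m_closed)
  finally show ?thesis .
qed

text \<open>The base point has stabilizer \<open>H\<close>, and translating by \<open>a\<close>
  conjugates it.\<close>

lemma stabilizer_base_point:
  assumes "a \<in> carrier G"
  shows "stabilizer G (coset_space H) (act (coset_space H) (\<iota> H, a)) = (inv a <# H) #> a"
proof -
  have C: "continuous_gset G T (coset_space H)"
    using coset_space_Ob by (simp add: Ob_Cont)
  have "H \<subseteq> carrier G"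
    using H open_subgroups_subset_Pow by blast
  then have "stabilizer G (coset_space H) (\<iota> H) = H"
    using coset_eq_iff [of _ \<one>] act_one [OF C base_point] by (auto simp: stabilizer_def)
  then show ?thesis
    using stabilizer_act [OF C base_point assms] by simp
qed

text \<open>Send the translate of the base point by \<open>a\<close> to the translate of
  \<open>x\<close> by \<open>a\<close>. The inclusion of \<open>H\<close> in the stabilizer makes
  this well defined, and equality makes it injective. With \<open>coset_space_map_eqI\<close>, maps
  out of \<open>G / H\<close> correspond to points fixed by \<open>H\<close>.\<close>

lemma orbit_map:
  assumes X: "continuous_gset G T X" and x: "x \<in> pts X" and stab: "H \<subseteq> stabilizer G X x"
  obtains f where "f \<in> equivariant_maps G (coset_space H) X" "f (\<iota> H) = x"
    "H = stabilizer G X x \<Longrightarrow> inj_on f (pts (coset_space H))"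
proof -
  let ?C = "coset_space H"
  have C: "continuous_gset G T ?C"
    using coset_space_Ob by (simp add: Ob_Cont)
  define f where "f = (\<lambda>z\<in>pts ?C. act X (x, SOME a. a \<in> carrier G \<and> z = act ?C (\<iota> H, a)))"
  have f: "f (act ?C (\<iota> H, a)) = act X (x, a)" if a: "a \<in> carrier G" for a
  proof -
    \<comment> \<open>The representative that \<open>f\<close> picks at this point; it may differ
      from \<open>a\<close> by a left factor in \<open>H\<close>, which fixes
      \<open>x\<close>.\<close>
    define b where "b = (SOME b. b \<in> carrier G \<and> act ?C (\<iota> H, a) = act ?C (\<iota> H, b))"
    have b: "b \<in> carrier G \<and> act ?C (\<iota> H, a) = act ?C (\<iota> H, b)"
      unfolding b_def by (rule someI [where x = a]) (simp add: a)
    then have "a \<otimes> inv b \<in> H"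
      using a coset_eq_iff by blast
    then have "act X (x, a) = act X (x, b)"
      using stab b a act_eq_iff [OF X x] by blast
    then show ?thesis
      using act_closed [OF C base_point a] by (simp add: f_def b_def)
  qed
  show thesis
  proof
    have "f z \<in> pts X" if "z \<in> pts ?C" for z
      using that by (rule coset_spaceE) (simp add: f act_closed [OF X x])
    then have "f \<in> pts ?C \<rightarrow>\<^sub>E pts X"
      unfolding f_def by auto
    moreover have "f (act ?C (z, g)) = act X (f z, g)" if "z \<in> pts ?C" "g \<in> carrier G" for z g
      using that(1) by (rule coset_spaceE)
        (simp add: f that(2) act_mult [OF C base_point] act_mult [OF X x])
    ultimately show "f \<in> equivariant_maps G ?C X"
      by (simp add: equivariant_maps_def)
    show "f (\<iota> H) = x"
      using f [of \<one>] act_one [OF C base_point] act_one [OF X x] by simp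
    assume eq: "H = stabilizer G X x"
    show "inj_on f (pts ?C)"
    proof (rule inj_onI)
      fix z w assume zw: "z \<in> pts ?C" "w \<in> pts ?C" "f z = f w"
      obtain a where a: "a \<in> carrier G" "z = act ?C (\<iota> H, a)"
        using zw(1) by (rule coset_spaceE)
      obtain b where b: "b \<in> carrier G" "w = act ?C (\<iota> H, b)"
        using zw(2) by (rule coset_spaceE)
      have "act X (x, a) = act X (x, b)"
        using zw(3) a b f by simp
      then have "a \<otimes> inv b \<in> H"
        using eq a b act_eq_iff [OF X x] by simp
      then show "z = w"
        using a b coset_eq_iff by simp
    qed
  qed
qed

end

section \<open>Monomorphisms are injective and preserve stabilizers\<close>

lemma monomorphism_inj_on:
  assumes X: "X \<in> Ob (Cont U G T)" and Y: "Y \<in> Ob (Cont U G T)"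
    and m: "monomorphism (Cont U G T) X Y m"
  shows "inj_on m (pts X)"
proof (rule inj_onI)
  fix x y assume x: "x \<in> pts X" and y: "y \<in> pts X" and eq: "m x = m y"
  have cX: "continuous_gset G T X"
    using X by (simp add: Ob_Cont)
  \<comment> \<open>An open subgroup inside both stabilizers gives the two orbit maps a common
    domain.\<close>
  define H where "H = stabilizer G X x \<inter> stabilizer G X y"
  have H: "H \<in> open_subgroups G T"
    using stabilizer_open_subgroup [OF cX x] stabilizer_open_subgroup [OF cX y]
    by (simp add: open_subgroups_def H_def openin_Int subgroups_Inter_pair)
  obtain f where f: "f \<in> equivariant_maps G (coset_space H) X" "f (\<iota> H) = x"
    using orbit_map [OF H cX x] H_def by blast
  obtain g where g: "g \<in> equivariant_maps G (coset_space H) X" "g (\<iota> H) = y"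
    using orbit_map [OF H cX y] H_def by blast
  have m': "m \<in> equivariant_maps G X Y"
    using m by (simp add: monomorphism_def)
  interpret Cont: category "Cont U G T"
    by (rule category_Cont)
  \<comment> \<open>Both composites send the base point to \<open>m x = m y\<close>, so they
    coincide and \<open>m\<close> can be cancelled.\<close>
  have "compose (pts (coset_space H)) m f = compose (pts (coset_space H)) m g"
  proof (rule coset_space_map_eqI [OF H])
    show "compose (pts (coset_space H)) m f \<in> equivariant_maps G (coset_space H) Y"
      using Cont.comp_mor [OF coset_space_Ob [OF H] X Y] f m' by (simp only: Mor_Cont Comp_Cont)
    show "compose (pts (coset_space H)) m g \<in> equivariant_maps G (coset_space H) Y"
      using Cont.comp_mor [OF coset_space_Ob [OF H] X Y] g m' by (simp only: Mor_Cont Comp_Cont)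
    show "compose (pts (coset_space H)) m f (\<iota> H) = compose (pts (coset_space H)) m g (\<iota> H)"
      using base_point [OF H] f g eq by (simp only: compose_eq)
  qed
  then have "f = g"
    using m f g coset_space_Ob [OF H] unfolding monomorphism_def Mor_Cont Comp_Cont by blast
  then show "x = y"
    using f g by simp
qed

text \<open>The cocone condition says that monomorphisms preserve stabilizers, which holds because
  they are injective.\<close>

lemma mono_cocone_classifying_map: "mono_cocone (Cont U G T) classifier classifying_map"
  unfolding mono_cocone_def
proof (intro conjI ballI allI impI)
  show "classifier \<in> Ob (Cont U G T)"
    by (rule classifier_Ob)
  show "classifying_map X \<in> Mor (Cont U G T) X classifier" if "X \<in> Ob (Cont U G T)" for X
    using that classifying_map_equivariant by simp
  fix X Y m
  assume X: "X \<in> Ob (Cont U G T)" and Y: "Y \<in> Ob (Cont U G T)"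
    and m: "monomorphism (Cont U G T) X Y m"
  have m': "m \<in> equivariant_maps G X Y"
    using m by (simp add: monomorphism_def)
  have cX: "continuous_gset G T X"
    using X by (simp add: Ob_Cont)
  have "stabilizer G Y (m x) = stabilizer G X x" if "x \<in> pts X" for x
    using stabilizer_inj_equivariant [OF m' monomorphism_inj_on [OF X Y m] that act_closed [OF cX that]] .
  then show "Comp (Cont U G T) X Y classifier (classifying_map Y) m = classifying_map X"
    using equivariantD(1) [OF m'] by (auto simp: compose_def classifying_map_def)
qed

section \<open>The universal property of the classifier\<close>

lemma mono_cocone_eq_base_point:
  assumes \<phi>: "mono_cocone (Cont U G T) L \<phi>" and X: "X \<in> Ob (Cont U G T)" and x: "x \<in> pts X"
  shows "\<phi> X x = \<phi> (coset_space (stabilizer G X x)) (\<iota> (stabilizer G X x))"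
proof -
  let ?H = "stabilizer G X x"
  have cX: "continuous_gset G T X"
    using X by (simp add: Ob_Cont)
  have H: "?H \<in> open_subgroups G T"
    by (rule stabilizer_open_subgroup [OF cX x])
  obtain f where f: "f \<in> equivariant_maps G (coset_space ?H) X" "f (\<iota> ?H) = x"
      "inj_on f (pts (coset_space ?H))"
    using orbit_map [OF H cX x] by blast
  \<comment> \<open>The domain is the coset space of the full stabilizer, so the orbit map is
    injective, hence a monomorphism to which the cocone condition applies.\<close>
  then have "compose (pts (coset_space ?H)) (\<phi> X) f = \<phi> (coset_space ?H)"
    using \<phi> X coset_space_Ob [OF H] inj_on_monomorphism
    unfolding mono_cocone_def Comp_Cont by blast
  then show ?thesis
    using f base_point [OF H] by (metis compose_eq)
qed

text \<open>Every point of the classifier is thus the value of some cocone component, which gives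
  uniqueness of the factorization.\<close>

lemma classifying_map_base_point:
  assumes "H \<in> open_subgroups G T"
  shows "classifying_map (coset_space H) (\<iota> H) = \<iota> H"
proof -
  have C: "continuous_gset G T (coset_space H)"
    using coset_space_Ob [OF assms] by (simp add: Ob_Cont)
  have "H \<subseteq> carrier G"
    using assms open_subgroups_subset_Pow by blast
  then have "stabilizer G (coset_space H) (\<iota> H) = H"
    using stabilizer_base_point [OF assms one_closed] act_one [OF C base_point [OF assms]]
      conjugate_one by simp
  then show ?thesis
    using base_point [OF assms] by (simp add: classifying_map_def del: pts_transport_gset)
qed

text \<open>The value of \<open>u\<close> at \<open>\<iota> H\<close> is forced: it must be that of
  \<open>\<phi>\<close> at the base point of \<open>G / H\<close>.\<close>

lemma mono_cocone_factorization:
  assumes \<phi>: "mono_cocone (Cont U G T) L \<phi>"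
  obtains u where "u \<in> equivariant_maps G classifier L"
    "\<And>X. X \<in> Ob (Cont U G T) \<Longrightarrow> compose (pts X) u (classifying_map X) = \<phi> X"
proof
  define u where "u = (\<lambda>y\<in>pts classifier.
    let H = the_inv_into (open_subgroups G T) \<iota> y in \<phi> (coset_space H) (\<iota> H))"
  have "inj_on \<iota> (open_subgroups G T)"
    using inj open_subgroups_subset_Pow by (rule inj_on_subset)
  then have u: "u (\<iota> H) = \<phi> (coset_space H) (\<iota> H)" if "H \<in> open_subgroups G T" for H
    using that by (simp add: u_def Let_def the_inv_into_f_f pts_classifier del: pts_transport_gset)
  have \<phi>_mor: "\<phi> X \<in> equivariant_maps G X L" if "X \<in> Ob (Cont U G T)" for X
    using \<phi> that by (simp add: mono_cocone_def)
  have "u \<in> pts classifier \<rightarrow>\<^sub>E pts L"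
  proof (rule PiE_I)
    fix y assume "y \<in> pts classifier"
    then obtain H where H: "H \<in> open_subgroups G T" "y = \<iota> H"
      unfolding pts_classifier by blast
    show "u y \<in> pts L"
      using equivariantD(1) [OF \<phi>_mor [OF coset_space_Ob] base_point] H u by simp
  qed (simp add: u_def)
  moreover have "u (act classifier (y, g)) = act L (u y, g)"
    if y: "y \<in> pts classifier" and g: "g \<in> carrier G" for y g
  proof -
    obtain H where H: "H \<in> open_subgroups G T" and y: "y = \<iota> H"
      using y unfolding pts_classifier by blast
    let ?C = "coset_space H" and ?K = "(inv g <# H) #> g"
    have C: "continuous_gset G T ?C"
      using coset_space_Ob [OF H] by (simp add: Ob_Cont)
    have K: "?K \<in> open_subgroups G T"
      using H g subgroup_conjugate openin_conjugate by (simp add: open_subgroups_def)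
    have "act L (u y, g) = \<phi> ?C (act ?C (\<iota> H, g))"
      using equivariantD(2) [OF \<phi>_mor [OF coset_space_Ob [OF H]] base_point [OF H] g] u [OF H] y
      by simp
    \<comment> \<open>The translated base point has stabilizer \<open>?K\<close>, so its value under
      \<open>\<phi>\<close> can be read off at the base point of \<open>G / ?K\<close>.\<close>
    also have "\<dots> = \<phi> (coset_space ?K) (\<iota> ?K)"
      using mono_cocone_eq_base_point [OF \<phi> coset_space_Ob [OF H] act_closed [OF C base_point [OF H] g]]
        stabilizer_base_point [OF H g] by simp
    also have "\<dots> = u (act classifier (y, g))"
      using u [OF K] act_classifier [OF H g] y by simp
    finally show ?thesis
      by simp
  qed
  ultimately show "u \<in> equivariant_maps G classifier L"
    by (simp add: equivariant_maps_def)
  fix X assume X: "X \<in> Ob (Cont U G T)"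
  then have cX: "continuous_gset G T X"
    by (simp add: Ob_Cont)
  show "compose (pts X) u (classifying_map X) = \<phi> X"
  \<comment> \<open>With codomain \<open>UNIV\<close>, membership means extensionality off
    \<open>pts X\<close>, which leaves a pointwise comparison.\<close>
  proof (rule PiE_ext [where k = "pts X" and s = "\<lambda>_. UNIV"])
    show "\<phi> X \<in> pts X \<rightarrow>\<^sub>E UNIV"
      using \<phi>_mor [OF X] by (auto simp: equivariant_maps_def PiE_iff)
    fix x assume x: "x \<in> pts X"
    then show "compose (pts X) u (classifying_map X) x = \<phi> X x"
      using u [OF stabilizer_open_subgroup [OF cX x]] mono_cocone_eq_base_point [OF \<phi> X x]
      by (simp add: compose_eq classifying_map_def)
  qed (auto simp: compose_def)
qed

text \<open>The components of the cocone are jointly surjective: \<open>\<iota> H\<close> is reached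
  from the base point of \<open>G / H\<close>.\<close>

lemma classifier_map_eqI:
  assumes u: "u \<in> equivariant_maps G classifier L" and v: "v \<in> equivariant_maps G classifier L"
    and eq: "\<And>X. X \<in> Ob (Cont U G T) \<Longrightarrow>
      compose (pts X) u (classifying_map X) = compose (pts X) v (classifying_map X)"
  shows "u = v"
proof (rule PiE_ext)
  show "u \<in> pts classifier \<rightarrow>\<^sub>E pts L" "v \<in> pts classifier \<rightarrow>\<^sub>E pts L"
    using u v by (auto simp only: equivariant_maps_def)
  fix y assume "y \<in> pts classifier"
  then obtain H where H: "H \<in> open_subgroups G T" "y = \<iota> H"
    unfolding pts_classifier by blast
  show "u y = v y"
    using fun_cong [OF eq [OF coset_space_Ob [OF H(1)]], of "\<iota> H"] H
    by (simp add: compose_eq base_point classifying_map_base_point del: pts_transport_gset)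
qed

lemma local_state_classifier_classifying_map:
  "local_state_classifier (Cont U G T) classifier classifying_map"
  unfolding local_state_classifier_def Mor_Cont Comp_Cont
proof (intro conjI allI impI)
  show "mono_cocone (Cont U G T) classifier classifying_map"
    by (rule mono_cocone_classifying_map)
  fix L \<phi> assume "mono_cocone (Cont U G T) L \<phi>"
  then obtain u where "u \<in> equivariant_maps G classifier L"
    "\<And>X. X \<in> Ob (Cont U G T) \<Longrightarrow> compose (pts X) u (classifying_map X) = \<phi> X"
    using mono_cocone_factorization by blast
  then show "\<exists>!u. u \<in> equivariant_maps G classifier L \<and>
      (\<forall>X\<in>Ob (Cont U G T). compose (pts X) u (classifying_map X) = \<phi> X)"
    by (intro ex1I [of _ u]) (auto intro: classifier_map_eqI)
qed

end

theorem corollary5p5: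
  fixes G :: "('g, 'b) monoid_scheme" and T :: "'g topology"
    and U :: "'u set set" and \<iota> :: "'g set \<Rightarrow> 'u"
  assumes "topological_group G T"
    and "small_sets U"
    and "inj_on \<iota> (Pow (carrier G))" and "\<iota> ` Pow (carrier G) \<in> U"
  shows "\<exists>\<xi>. local_state_classifier (Cont U G T) (transport_gset G \<iota> (open_subgroups_gset G T)) \<xi>"
proof -
  interpret small_continuous_gsets G T U \<iota>
    using assms by (intro small_continuous_gsets.intro small_continuous_gsets_axioms.intro)
  show ?thesis
    using local_state_classifier_classifying_map by blast
qed

end
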